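(* Let $k,t\ge 1$ be integers and let $\mathbb{F}$ be a field. If there exists a collection of $m = k \cdot (t-1) +1$ nonzero vectors in $\mathbb{F}^k$ satisfying that every $t$ of them span the entire space $\mathbb{F}^{k}$, then $m(k,\mathbb{F}) \leq m$.
   Context: Inner product: on $\mathbb{C}^t$, $\langle x,y\rangle=\sum_i x_i\overline{y_i}$; on $\mathbb{F}^t$ for every other field $\mathbb{F}$ (in particular $\mathbb{R}$ and finite fields), $\langle x,y\rangle=\sum_i x_iy_i$. A finite simple graph $G=(V,E)$ is $k$-subspace choosable over $\mathbb{F}$ if for every integer $s$ and every assignment of subspaces $W_v\subseteq\mathbb{F}^s$ with $\dim(W_v)=k$ to the vertices $v\in V$, there exists a choice of a nonzero vector $x_v\in W_v$ for each $v\in V$ such that $\langle x_v,x_{v'}\rangle=0$ whenever $v$ and $v'$ are adjacent in $G$. The subspace choice number $\mathrm{ch\text{-}s}(G,\mathbb{F})$ is the smallest positive integer $k$ for which $G$ is $k$-subspace choosable over $\mathbb{F}$. $K_{k,m}$ is the complete bipartite graph with $k$ vertices on the left side and $m$ on the right side. It always satisfies $\mathrm{ch\text{-}s}(K_{k,m},\mathbb{F})\le k+1$. For an integer $k$ and a field $\mathbb{F}$, $m(k,\mathbb{F})$ denotes the smallest integer $m$ for which $\mathrm{ch\text{-}s}(K_{k,m},\mathbb{F})=k+1$. *)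

theory Defs
  imports Complex_Main "HOL-Library.Function_Algebras" "HOL-Library.Extended_Nat"
begin

text \<open>The space \<open>F\<^sup>s\<close> has to be available for varying \<open>s\<close>, so its vectors are the sequences
  supported on \<open>{..<s}\<close>; linear algebra is that of all sequences, with pointwise operations.\<close>

definition vscale :: "'a::field \<Rightarrow> (nat \<Rightarrow> 'a) \<Rightarrow> nat \<Rightarrow> 'a" where
  "vscale c x = (\<lambda>i. c * x i)"

global_interpretation fvec: vector_space "vscale :: 'a::field \<Rightarrow> (nat \<Rightarrow> 'a) \<Rightarrow> nat \<Rightarrow> 'a"
  by unfold_locales (auto simp: vscale_def algebra_simps fun_eq_iff)

definition coord_space :: "nat \<Rightarrow> (nat \<Rightarrow> 'a::field) set" where
  "coord_space s = {x. \<forall>i\<ge>s. x i = 0}"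

lemma subspace_coord_space: "fvec.subspace (coord_space s)"
  by (auto simp: fvec.subspace_def coord_space_def vscale_def)

text \<open>The inner product on \<open>F\<^sup>s\<close> is \<open>hermitian_ip s\<close> over the complex numbers and
  \<open>bilinear_ip s\<close> over every other field. Since a definition cannot test whether its type
  argument is \<^typ>\<open>complex\<close>, the notions below take the inner product as a parameter.\<close>

type_synonym 'a ip = "nat \<Rightarrow> (nat \<Rightarrow> 'a) \<Rightarrow> (nat \<Rightarrow> 'a) \<Rightarrow> 'a"

definition bilinear_ip :: "'a::field ip" where
  "bilinear_ip s x y = (\<Sum>i<s. x i * y i)"

definition hermitian_ip :: "complex ip" where
  "hermitian_ip s x y = (\<Sum>i<s. x i * cnj (y i))"

type_synonym 'v graph = "'v set \<times> 'v set set"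

definition finite_simple_graph :: "'v graph \<Rightarrow> bool" where
  "finite_simple_graph G \<longleftrightarrow> finite (fst G) \<and> (\<forall>e\<in>snd G. e \<subseteq> fst G \<and> card e = 2)"

definition complete_bipartite :: "nat \<Rightarrow> nat \<Rightarrow> (nat + nat) graph" where
  "complete_bipartite k m =
     (Inl ` {..<k} \<union> Inr ` {..<m}, {{Inl i, Inr j} | i j. i < k \<and> j < m})"

lemma finite_simple_graph_complete_bipartite: "finite_simple_graph (complete_bipartite k m)"
  by (auto simp: finite_simple_graph_def complete_bipartite_def)

definition subspace_choosable :: "'a::field ip \<Rightarrow> nat \<Rightarrow> 'v graph \<Rightarrow> bool" where
  "subspace_choosable ip k G \<longleftrightarrow>
     (\<forall>s W. (\<forall>v\<in>fst G. fvec.subspace (W v) \<and> W v \<subseteq> coord_space s \<and> fvec.dim (W v) = k) \<longrightarrow>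
        (\<exists>x. (\<forall>v\<in>fst G. x v \<in> W v \<and> x v \<noteq> 0) \<and>
             (\<forall>v v'. {v, v'} \<in> snd G \<longrightarrow> ip s (x v) (x v') = 0)))"

text \<open>Minima are taken in \<^typ>\<open>enat\<close>, where the infimum of a nonempty set is its least element
  and that of the empty set is \<open>\<infinity>\<close>; so a finite upper bound includes existence.\<close>

definition subspace_choice_number :: "'a::field ip \<Rightarrow> 'v graph \<Rightarrow> enat" where
  "subspace_choice_number ip G = Inf {enat k | k. 0 < k \<and> subspace_choosable ip k G}"

definition bipartite_threshold :: "'a::field ip \<Rightarrow> nat \<Rightarrow> enat" where
  "bipartite_threshold ip k =
     Inf {enat m | m. subspace_choice_number ip (complete_bipartite k m) = enat (k + 1)}"

text \<open>A collection is an indexed family, so repetitions are allowed and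
  ``every \<open>t\<close> of them'' refers to \<open>t\<close> distinct indices.\<close>

definition spanning_family :: "nat \<Rightarrow> nat \<Rightarrow> nat \<Rightarrow> (nat \<Rightarrow> nat \<Rightarrow> 'a::field) \<Rightarrow> bool" where
  "spanning_family k t m u \<longleftrightarrow>
     (\<forall>j<m. u j \<in> coord_space k \<and> u j \<noteq> 0) \<and>
     (\<forall>I \<subseteq> {..<m}. card I = t \<longrightarrow> fvec.span (u ` I) = coord_space k)"

end

theory Submission
  imports Defs
begin

text \<open>
  Identify \<open>F\<close>-vectors of length \<open>k\<^sup>2\<close> with sums of tensors \<open>w \<otimes> a\<close> of vectors of length \<open>k\<close>;
  the inner product is then multiplicative on tensors,
  \<open>\<langle>w \<otimes> a, w' \<otimes> a'\<rangle> = \<langle>w, w'\<rangle> \<langle>a, a'\<rangle>\<close>.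
  Let \<open>u\<^sub>0, \<dots>, u\<^sub>m\<^sub>-\<^sub>1\<close> be nonzero vectors of which every \<open>t\<close> span \<open>F\<^sup>k\<close>. Assign to the left vertex \<open>i\<close> the space
  \<open>e\<^sub>i \<otimes> F\<^sup>k\<close> and to the right vertex \<open>j\<close> the space \<open>F\<^sup>k \<otimes> u\<^sub>j\<close>; all of these have dimension \<open>k\<close>.
  Suppose that \<open>e\<^sub>i \<otimes> a\<^sub>i\<close> and \<open>w\<^sub>j \<otimes> u\<^sub>j\<close> are nonzero and that all pairs are orthogonal. For every
  \<open>j\<close> some entry of \<open>w\<^sub>j\<close> is nonzero, say the one with index \<open>i\<close>, and then \<open>a\<^sub>i\<close> is orthogonal to
  \<open>u\<^sub>j\<close>. As \<open>m > k (t - 1)\<close>, the pigeonhole principle yields one \<open>a\<^sub>i\<close> that is orthogonal to \<open>t\<close> of the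
  vectors \<open>u\<^sub>j\<close>. These span \<open>F\<^sup>k\<close>, so \<open>a\<^sub>i = 0\<close>, a contradiction. Hence \<open>K\<^sub>k\<^sub>,\<^sub>m\<close> is not \<open>k\<close>-subspace
  choosable (lemma \<open>not_choosable_of_spanning_family\<close>).

  Passing to subspaces shows that choosability is monotone in the dimension, so no positive number
  up to \<open>k\<close> works either. On the other hand \<open>k + 1\<close> always works, because the \<open>k\<close> vectors chosen on
  the left impose only \<open>k\<close> homogeneous linear conditions on a space of dimension \<open>k + 1\<close> on the right.

  The bilinear and the Hermitian inner product are treated together: both are
  \<open>\<Sum>\<^sub>i x\<^sub>i \<sigma>(y\<^sub>i)\<close> for an involutive field automorphism \<open>\<sigma>\<close>, the identity or complex conjugation.
\<close>

section \<open>Linear algebra in coordinate spaces\<close>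

global_interpretation fvec_pair: vector_space_pair
  "vscale :: 'a::field \<Rightarrow> (nat \<Rightarrow> 'a) \<Rightarrow> nat \<Rightarrow> 'a" "vscale :: 'a \<Rightarrow> (nat \<Rightarrow> 'a) \<Rightarrow> nat \<Rightarrow> 'a"
  by unfold_locales

abbreviation fvec_linear :: "((nat \<Rightarrow> 'a::field) \<Rightarrow> nat \<Rightarrow> 'a) \<Rightarrow> bool" where
  "fvec_linear \<equiv> Vector_Spaces.linear vscale vscale"

lemma fvec_linearI:
  assumes "\<And>x y. f (x + y) = f x + f y" "\<And>c x. f (vscale c x) = vscale c (f x)"
  shows "fvec_linear f"
  unfolding Vector_Spaces.linear_iff
  using assms fvec.vector_space_axioms by blast

definition unit_vec :: "nat \<Rightarrow> nat \<Rightarrow> 'a::field" where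
  "unit_vec i = (\<lambda>j. if j = i then 1 else 0)"

lemma unit_vec_in_coord_space [simp]: "i < s \<Longrightarrow> unit_vec i \<in> coord_space s"
  by (auto simp: coord_space_def unit_vec_def)

lemma inj_unit_vec: "inj (unit_vec :: nat \<Rightarrow> nat \<Rightarrow> 'a::field)"
  by (auto simp: inj_def unit_vec_def fun_eq_iff split: if_splits)

lemma unit_vec_nonzero [simp]: "unit_vec i \<noteq> (0 :: nat \<Rightarrow> 'a::field)"
  by (auto simp: unit_vec_def fun_eq_iff)

lemma sum_fun_apply: "(\<Sum>i\<in>A. f i) x = (\<Sum>i\<in>A. f i x)"
  for f :: "'b \<Rightarrow> 'c \<Rightarrow> 'a::comm_monoid_add"
  by (induction A rule: infinite_finite_induct) auto

lemma unit_vec_expansion: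
  assumes "x \<in> coord_space s"
  shows "x = (\<Sum>i<s. vscale (x i) (unit_vec i))"
proof
  fix j
  have "(\<Sum>i<s. vscale (x i) (unit_vec i)) j = (\<Sum>i<s. if j = i then x i else 0)"
    unfolding sum_fun_apply by (rule sum.cong) (auto simp: vscale_def unit_vec_def)
  also have "\<dots> = x j"
    using assms by (auto simp: coord_space_def)
  finally show "x j = (\<Sum>i<s. vscale (x i) (unit_vec i)) j" by simp
qed

lemma span_unit_vecs:
  "fvec.span (unit_vec ` {..<s}) = (coord_space s :: (nat \<Rightarrow> 'a::field) set)"
proof
  show "fvec.span (unit_vec ` {..<s}) \<subseteq> coord_space s"
    by (rule fvec.span_minimal[OF _ subspace_coord_space]) auto
  show "coord_space s \<subseteq> fvec.span ((unit_vec :: nat \<Rightarrow> nat \<Rightarrow> 'a) ` {..<s})"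
  proof
    fix x :: "nat \<Rightarrow> 'a" assume "x \<in> coord_space s"
    moreover have "(\<Sum>i<s. vscale (x i) (unit_vec i)) \<in> fvec.span (unit_vec ` {..<s})"
      by (intro fvec.span_sum fvec.span_scale fvec.span_base) auto
    ultimately show "x \<in> fvec.span (unit_vec ` {..<s})"
      using unit_vec_expansion by metis
  qed
qed

lemma card_unit_vecs: "card ((unit_vec :: nat \<Rightarrow> nat \<Rightarrow> 'a::field) ` {..<s}) = s"
  by (metis card_image card_lessThan inj_on_subset inj_unit_vec subset_UNIV)

lemma independent_unit_vecs:
  "fvec.independent ((unit_vec :: nat \<Rightarrow> nat \<Rightarrow> 'a::field) ` {..<s})"
proof -
  have "g (unit_vec i) = 0" if "i < s" "(\<Sum>v\<in>unit_vec ` {..<s}. vscale (g v) v) = 0"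
    for g :: "(nat \<Rightarrow> 'a) \<Rightarrow> 'a" and i
  proof -
    have "(\<Sum>v\<in>unit_vec ` {..<s}. vscale (g v) v) = (\<Sum>j<s. vscale (g (unit_vec j)) (unit_vec j))"
      by (rule sum.reindex_cong[OF inj_on_subset[OF inj_unit_vec]]) auto
    then have "0 = (\<Sum>j<s. vscale (g (unit_vec j)) (unit_vec j) i)"
      using that(2) by (metis sum_fun_apply zero_fun_apply)
    also have "\<dots> = (\<Sum>j<s. if i = j then g (unit_vec j) else 0)"
      by (rule sum.cong) (auto simp: vscale_def unit_vec_def)
    finally show ?thesis using that by simp
  qed
  then show ?thesis
    by (auto simp: fvec.dependent_finite)
qed

lemma dim_injective_image_coord_space:
  assumes lin: "fvec_linear f" and ker: "\<And>x. x \<in> coord_space k \<Longrightarrow> f x = 0 \<Longrightarrow> x = 0"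
  shows "fvec.dim (f ` coord_space k) = k"
proof -
  let ?U = "unit_vec ` {..<k} :: (nat \<Rightarrow> 'a) set"
  have inj: "inj_on f (fvec.span ?U)"
    unfolding span_unit_vecs
    using fvec_pair.linear_inj_on_iff_eq_0[OF lin subspace_coord_space] ker by blast
  have "fvec.dim (fvec.span (f ` ?U)) = card (f ` ?U)"
    using fvec_pair.linear_independent_injective_image[OF lin independent_unit_vecs inj]
    by (simp add: fvec.dim_eq_card_independent)
  also have "\<dots> = k"
    using inj_on_subset[OF inj fvec.span_superset] by (simp add: card_image card_unit_vecs)
  finally show ?thesis
    by (simp add: fvec_pair.linear_span_image[OF lin] span_unit_vecs)
qed

text \<open>A linear map into a space of smaller dimension cannot be injective.\<close>

lemma ex_nonzero_in_kernel:
  assumes lin: "fvec_linear f" and W: "fvec.subspace W" "n < fvec.dim W"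
    and range: "\<And>x. x \<in> W \<Longrightarrow> f x \<in> coord_space n"
  shows "\<exists>x\<in>W. x \<noteq> 0 \<and> f x = 0"
proof (rule ccontr)
  assume "\<not> ?thesis"
  then have "inj_on f W"
    using fvec_pair.linear_inj_on_iff_eq_0[OF lin W(1)] by blast
  obtain B where B: "B \<subseteq> W" "fvec.independent B" "W \<subseteq> fvec.span B" "card B = fvec.dim W"
    using fvec.basis_exists .
  have "fvec.span B = W"
    using B W(1) by (simp add: fvec.span_subspace)
  with \<open>inj_on f W\<close> have inj: "inj_on f (fvec.span B)" by simp
  have "f ` B \<subseteq> fvec.span (unit_vec ` {..<n})"
    using B(1) range by (auto simp: span_unit_vecs)
  then have "card (f ` B) \<le> card ((unit_vec :: nat \<Rightarrow> nat \<Rightarrow> 'a) ` {..<n})"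
    using fvec.independent_span_bound
      fvec_pair.linear_independent_injective_image[OF lin B(2) inj] by blast
  moreover have "card (f ` B) = fvec.dim W"
    using inj_on_subset[OF inj fvec.span_superset] B(4) by (simp add: card_image)
  ultimately show False
    using W(2) by (simp add: card_unit_vecs)
qed

lemma ex_subspace_of_dim:
  assumes "fvec.subspace W" "j \<le> fvec.dim W"
  shows "\<exists>U\<subseteq>W. fvec.subspace U \<and> fvec.dim U = j"
proof -
  obtain B where B: "B \<subseteq> W" "fvec.independent B" "W \<subseteq> fvec.span B" "card B = fvec.dim W"
    using fvec.basis_exists .
  obtain C where C: "C \<subseteq> B" "card C = j"
    using obtain_subset_with_card_n assms(2) B(4) by metis
  then have "fvec.dim (fvec.span C) = j"
    using fvec.independent_mono[OF B(2)] by (simp add: fvec.dim_eq_card_independent)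
  moreover have "fvec.span C \<subseteq> W"
    using C(1) B(1) assms(1) by (intro fvec.span_minimal) auto
  ultimately show ?thesis by blast
qed

section \<open>Tensors as vectors of length k squared\<close>

definition tensor :: "nat \<Rightarrow> (nat \<Rightarrow> 'a::field) \<Rightarrow> (nat \<Rightarrow> 'a) \<Rightarrow> nat \<Rightarrow> 'a" where
  "tensor k w a = (\<lambda>p. if p < k * k then w (p div k) * a (p mod k) else 0)"

lemma tensor_in_coord_space: "tensor k w a \<in> coord_space (k * k)"
  by (auto simp: tensor_def coord_space_def)

lemma tensor_apply:
  assumes "i < k" "l < k"
  shows "tensor k w a (i * k + l) = w i * a l"
proof -
  have "i * k + l < Suc i * k" using assms by simp
  also have "\<dots> \<le> k * k" using assms by (intro mult_right_mono) auto
  finally show ?thesis using assms by (simp add: tensor_def)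
qed

lemma linear_tensor_left: "fvec_linear (\<lambda>w. tensor k w a)"
  by (rule fvec_linearI) (auto simp: tensor_def vscale_def fun_eq_iff algebra_simps)

lemma linear_tensor_right: "fvec_linear (tensor k w)"
  by (rule fvec_linearI) (auto simp: tensor_def vscale_def fun_eq_iff algebra_simps)

lemma coord_space_nonzero_entry:
  assumes "x \<in> coord_space k" "x \<noteq> 0"
  shows "\<exists>i<k. x i \<noteq> 0"
  using assms by (fastforce simp: coord_space_def fun_eq_iff not_le)

lemma tensor_nonzero:
  assumes "w \<in> coord_space k" "w \<noteq> 0" "a \<in> coord_space k" "a \<noteq> 0"
  shows "tensor k w a \<noteq> 0"
proof -
  obtain i l where "i < k" "w i \<noteq> 0" "l < k" "a l \<noteq> 0"
    using coord_space_nonzero_entry assms by metis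
  then have "tensor k w a (i * k + l) \<noteq> 0" by (simp add: tensor_apply)
  then show ?thesis by force
qed

section \<open>The inner product attached to a field involution\<close>

locale field_involution =
  fixes \<sigma> :: "'a::field \<Rightarrow> 'a"
  assumes involution_add: "\<sigma> (a + b) = \<sigma> a + \<sigma> b"
    and involution_mult: "\<sigma> (a * b) = \<sigma> a * \<sigma> b"
    and involution_involution: "\<sigma> (\<sigma> a) = a"
begin

definition pairing :: "'a ip" where
  "pairing s x y = (\<Sum>i<s. x i * \<sigma> (y i))"

lemma involution_zero: "\<sigma> 0 = 0"
  by (metis involution_add add_cancel_right_right add_0)

lemma involution_eq_zero_iff: "\<sigma> a = 0 \<longleftrightarrow> a = 0"
  by (metis involution_zero involution_involution)

lemma involution_sum: "\<sigma> (\<Sum>i\<in>A. f i) = (\<Sum>i\<in>A. \<sigma> (f i))"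
  by (induction A rule: infinite_finite_induct) (auto simp: involution_zero involution_add)

lemma involution_pairing: "\<sigma> (pairing s x y) = pairing s y x"
  by (simp add: pairing_def involution_sum involution_mult involution_involution mult.commute)

lemma pairing_eq_zero_commute: "pairing s x y = 0 \<longleftrightarrow> pairing s y x = 0"
  by (metis involution_pairing involution_eq_zero_iff)

lemma pairing_add_left: "pairing s (x + y) z = pairing s x z + pairing s y z"
  by (simp add: pairing_def algebra_simps sum.distrib)

lemma pairing_scale_left: "pairing s (vscale c x) z = c * pairing s x z"
  by (simp add: pairing_def vscale_def sum_distrib_left mult.assoc)

lemma pairing_unit_vec_left:
  assumes "i < s"
  shows "pairing s (unit_vec i) y = \<sigma> (y i)"
proof -
  have "pairing s (unit_vec i) y = (\<Sum>j<s. if j = i then \<sigma> (y j) else 0)"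
    unfolding pairing_def by (rule sum.cong) (auto simp: unit_vec_def)
  then show ?thesis using assms by simp
qed

lemma pairing_tensor:
  "pairing (k * k) (tensor k w a) (tensor k w' a') = pairing k w w' * pairing k a a'"
proof -
  let ?f = "\<lambda>p. tensor k w a p * \<sigma> (tensor k w' a' p)"
  have "pairing (k * k) (tensor k w a) (tensor k w' a') = (\<Sum>i<k. \<Sum>p = i * k..<i * k + k. ?f p)"
    unfolding pairing_def by (rule sum.nat_group[symmetric])
  also have "\<dots> = (\<Sum>i<k. \<Sum>l<k. ?f (i * k + l))"
    using sum.shift_bounds_nat_ivl[of ?f 0 "_ * k" k]
    by (simp add: atLeast0LessThan add.commute)
  also have "\<dots> = (\<Sum>i<k. \<Sum>l<k. (w i * \<sigma> (w' i)) * (a l * \<sigma> (a' l)))"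
    by (intro sum.cong refl) (simp add: tensor_apply involution_mult)
  finally show ?thesis
    by (simp add: pairing_def sum_product)
qed

lemma orthogonal_to_spanning_set:
  assumes "fvec.span S = coord_space k" "a \<in> coord_space k"
    and orth: "\<And>u. u \<in> S \<Longrightarrow> pairing k a u = 0"
  shows "a = 0"
proof -
  have "fvec.subspace {y. pairing k y a = 0}"
    by (auto simp: fvec.subspace_def pairing_add_left pairing_scale_left)
       (simp add: pairing_def)
  moreover have "S \<subseteq> {y. pairing k y a = 0}"
    using orth pairing_eq_zero_commute by blast
  ultimately have "coord_space k \<subseteq> {y. pairing k y a = 0}"
    using fvec.span_minimal assms(1) by metis
  then have "pairing k (unit_vec i) a = 0" if "i < k" for i
    using that unit_vec_in_coord_space by blast
  then have "a i = 0" if "i < k" for i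
    using that by (simp add: pairing_unit_vec_left involution_eq_zero_iff)
  then show ?thesis
    using coord_space_nonzero_entry[OF assms(2)] by blast
qed

section \<open>Choosability of complete bipartite graphs\<close>

text \<open>The right vectors may be chosen independently of each other, since there are no edges between
  them; each only has to satisfy the \<open>k\<close> linear conditions imposed by the left side.\<close>

lemma choosable_Suc: "subspace_choosable pairing (k + 1) (complete_bipartite k m)"
  unfolding subspace_choosable_def
proof (intro allI impI)
  fix s and W :: "nat + nat \<Rightarrow> (nat \<Rightarrow> 'a) set"
  let ?V = "fst (complete_bipartite k m)"
  assume "\<forall>v\<in>?V. fvec.subspace (W v) \<and> W v \<subseteq> coord_space s \<and> fvec.dim (W v) = k + 1"
  then have W: "fvec.subspace (W v)" "fvec.dim (W v) = k + 1" if "v \<in> ?V" for v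
    using that by auto
  have "\<exists>x\<in>W v. x \<noteq> 0" if "v \<in> ?V" for v
    using ex_nonzero_in_kernel[of "\<lambda>_. 0" "W v" k] W[OF that] that
    by (force simp: coord_space_def intro!: fvec_linearI simp: vscale_def fun_eq_iff)
  then obtain x where x: "x v \<in> W v" "x v \<noteq> 0" if "v \<in> ?V" for v
    by metis
  define T where "T y = (\<lambda>i. if i < k then pairing s y (x (Inl i)) else 0)" for y
  have "fvec_linear T"
    by (rule fvec_linearI)
       (auto simp: T_def fun_eq_iff pairing_add_left pairing_scale_left, simp_all add: vscale_def)
  moreover have "T y \<in> coord_space k" for y
    by (simp add: T_def coord_space_def)
  ultimately have "\<exists>y\<in>W v. y \<noteq> 0 \<and> T y = 0" if "v \<in> ?V" for v
    using W[OF that] by (intro ex_nonzero_in_kernel[where n = k]) auto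
  then obtain y where y: "y v \<in> W v" "y v \<noteq> 0" "T (y v) = 0" if "v \<in> ?V" for v
    by metis
  define z where "z v = (if v \<in> range Inl then x v else y v)" for v :: "nat + nat"
  have orth: "pairing s (y (Inr j)) (x (Inl i)) = 0" if "i < k" "j < m" for i j
  proof -
    have "T (y (Inr j)) i = 0" using y(3)[of "Inr j"] that by (simp add: complete_bipartite_def)
    then show ?thesis using that by (simp add: T_def)
  qed
  then have "pairing s (x (Inl i)) (y (Inr j)) = 0" if "i < k" "j < m" for i j
    using that pairing_eq_zero_commute by blast
  with orth have "\<forall>v v'. {v, v'} \<in> snd (complete_bipartite k m) \<longrightarrow> pairing s (z v) (z v') = 0"
    by (auto simp: complete_bipartite_def doubleton_eq_iff z_def)
  moreover have "\<forall>v\<in>?V. z v \<in> W v \<and> z v \<noteq> 0"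
    using x y by (auto simp: z_def)
  ultimately show "\<exists>x. (\<forall>v\<in>?V. x v \<in> W v \<and> x v \<noteq> 0) \<and>
      (\<forall>v v'. {v, v'} \<in> snd (complete_bipartite k m) \<longrightarrow> pairing s (x v) (x v') = 0)"
    by blast
qed

text \<open>The counterexample \<open>e\<^sub>i \<otimes> F\<^sup>k\<close>, \<open>F\<^sup>k \<otimes> u\<^sub>j\<close>: orthogonality of \<open>e\<^sub>i \<otimes> a\<^sub>i\<close> and \<open>w\<^sub>j \<otimes> u\<^sub>j\<close> means
  that the \<open>i\<close>-th entry of \<open>w\<^sub>j\<close> vanishes or \<open>a\<^sub>i\<close> is orthogonal to \<open>u\<^sub>j\<close>.\<close>

lemma not_choosable_of_spanning_family:
  fixes u :: "nat \<Rightarrow> nat \<Rightarrow> 'a"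
  assumes m: "m = k * (t - 1) + 1" and u: "spanning_family k t m u"
  shows "\<not> subspace_choosable pairing k (complete_bipartite k m)"
proof
  define W :: "nat + nat \<Rightarrow> (nat \<Rightarrow> 'a) set" where "W v = (case v of Inl i \<Rightarrow> tensor k (unit_vec i) ` coord_space k
                                 | Inr j \<Rightarrow> (\<lambda>w. tensor k w (u j)) ` coord_space k)" for v
  have u_nz: "u j \<in> coord_space k" "u j \<noteq> 0" if "j < m" for j
    using u that by (auto simp: spanning_family_def)
  have "fvec.subspace (W v) \<and> W v \<subseteq> coord_space (k * k) \<and> fvec.dim (W v) = k"
    if "v \<in> fst (complete_bipartite k m)" for v
  proof (cases v)
    case (Inl i)
    then have "i < k" using that by (auto simp: complete_bipartite_def)
    then have "fvec.dim (W v) = k"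
      unfolding W_def Inl sum.case
      by (intro dim_injective_image_coord_space linear_tensor_right)
         (use tensor_nonzero unit_vec_nonzero unit_vec_in_coord_space in blast)
    then show ?thesis
      by (auto simp: W_def Inl tensor_in_coord_space
          intro!: fvec_pair.linear_subspace_image linear_tensor_right subspace_coord_space)
  next
    case (Inr j)
    then have "j < m" using that by (auto simp: complete_bipartite_def)
    then have "fvec.dim (W v) = k"
      unfolding W_def Inr sum.case
      by (intro dim_injective_image_coord_space linear_tensor_left)
         (use tensor_nonzero u_nz in blast)
    then show ?thesis
      by (auto simp: W_def Inr tensor_in_coord_space
          intro!: fvec_pair.linear_subspace_image linear_tensor_left subspace_coord_space)
  qed
  moreover assume "subspace_choosable pairing k (complete_bipartite k m)"
  ultimately obtain x :: "nat + nat \<Rightarrow> nat \<Rightarrow> 'a" where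
    x: "\<And>v. v \<in> fst (complete_bipartite k m) \<Longrightarrow> x v \<in> W v \<and> x v \<noteq> 0" and
    orth: "\<And>v v'. {v, v'} \<in> snd (complete_bipartite k m) \<Longrightarrow> pairing (k * k) (x v) (x v') = 0"
    unfolding subspace_choosable_def by metis
  have "\<exists>a\<in>coord_space k. x (Inl i) = tensor k (unit_vec i) a \<and> a \<noteq> 0" if "i < k" for i
  proof -
    have xi: "x (Inl i) \<in> W (Inl i)" "x (Inl i) \<noteq> 0"
      using x[of "Inl i"] that by (simp_all add: complete_bipartite_def)
    then obtain a where "a \<in> coord_space k" "x (Inl i) = tensor k (unit_vec i) a"
      by (auto simp: W_def)
    moreover have "tensor k (unit_vec i) 0 = (0 :: nat \<Rightarrow> 'a)"
      by (auto simp: tensor_def)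
    ultimately show ?thesis
      using xi(2) by auto
  qed
  then obtain a where a: "a i \<in> coord_space k" "x (Inl i) = tensor k (unit_vec i) (a i)" "a i \<noteq> 0"
    if "i < k" for i by metis
  have "\<exists>i<k. pairing k (a i) (u j) = 0" if "j < m" for j
  proof -
    have xj: "x (Inr j) \<in> W (Inr j)" "x (Inr j) \<noteq> 0"
      using x[of "Inr j"] that by (simp_all add: complete_bipartite_def)
    then obtain w where w: "w \<in> coord_space k" "x (Inr j) = tensor k w (u j)"
      by (auto simp: W_def)
    moreover have "tensor k 0 (u j) = 0"
      by (auto simp: tensor_def)
    ultimately have "w \<noteq> 0"
      using xj(2) by auto
    with w(1) obtain i where i: "i < k" "w i \<noteq> 0"
      using coord_space_nonzero_entry by blast
    have "{Inl i, Inr j} \<in> snd (complete_bipartite k m)"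
      using i(1) that by (auto simp: complete_bipartite_def)
    from orth[OF this] have "\<sigma> (w i) * pairing k (a i) (u j) = 0"
      by (simp add: a(2) w(2) i(1) pairing_tensor pairing_unit_vec_left)
    then show ?thesis using i by (auto simp: involution_eq_zero_iff)
  qed
  then obtain c where c: "c j < k" "pairing k (a (c j)) (u j) = 0" if "j < m" for j
    by metis
  \<comment> \<open>If every colour class of \<open>c\<close> had fewer than \<open>t\<close> elements, then \<open>m \<le> k (t - 1)\<close>.\<close>
  have "\<exists>i<k. t \<le> card {j. j < m \<and> c j = i}"
  proof (rule ccontr)
    assume "\<not> ?thesis"
    then have "card {j. j < m \<and> c j = i} < t" if "i < k" for i
      using that by (simp add: not_le)
    then have small: "card {j. j < m \<and> c j = i} \<le> t - 1" if "i < k" for i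
      using that by fastforce
    have "{..<m} = (\<Union>i<k. {j. j < m \<and> c j = i})" using c(1) by auto
    then have "m \<le> (\<Sum>i<k. card {j. j < m \<and> c j = i})"
      by (metis card_UN_le card_lessThan finite_lessThan)
    also have "\<dots> \<le> (\<Sum>i<k. t - 1)" using small by (intro sum_mono) auto
    finally show False using m by simp
  qed
  then obtain i I where i: "i < k" and I: "I \<subseteq> {j. j < m \<and> c j = i}" "card I = t"
    by (meson obtain_subset_with_card_n)
  have "fvec.span (u ` I) = coord_space k"
    using u I unfolding spanning_family_def by blast
  moreover have "pairing k (a i) v = 0" if "v \<in> u ` I" for v
    using that I(1) c(2) by auto
  ultimately have "a i = 0"
    using orthogonal_to_spanning_set a(1)[OF i] by blast
  with a(3)[OF i] show False ..
qed

end

lemma subspace_choosable_mono: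
  fixes ip :: "'a::field ip" and G :: "'v graph"
  assumes "subspace_choosable ip j G" "j \<le> k"
  shows "subspace_choosable ip k G"
  unfolding subspace_choosable_def
proof (intro allI impI)
  fix s and W :: "'v \<Rightarrow> (nat \<Rightarrow> 'a) set"
  assume W: "\<forall>v\<in>fst G. fvec.subspace (W v) \<and> W v \<subseteq> coord_space s \<and> fvec.dim (W v) = k"
  then have "\<forall>v\<in>fst G. \<exists>U\<subseteq>W v. fvec.subspace U \<and> fvec.dim U = j"
    using ex_subspace_of_dim assms(2) by metis
  then obtain U :: "'v \<Rightarrow> (nat \<Rightarrow> 'a) set" where
    U: "\<And>v. v \<in> fst G \<Longrightarrow> U v \<subseteq> W v \<and> fvec.subspace (U v) \<and> fvec.dim (U v) = j"
    by metis
  then have "\<forall>v\<in>fst G. fvec.subspace (U v) \<and> U v \<subseteq> coord_space s \<and> fvec.dim (U v) = j"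
    using W by blast
  then obtain x where "\<forall>v\<in>fst G. x v \<in> U v \<and> x v \<noteq> 0"
    "\<forall>v v'. {v, v'} \<in> snd G \<longrightarrow> ip s (x v) (x v') = 0"
    using assms(1) unfolding subspace_choosable_def by metis
  then show "\<exists>x. (\<forall>v\<in>fst G. x v \<in> W v \<and> x v \<noteq> 0) \<and>
      (\<forall>v v'. {v, v'} \<in> snd G \<longrightarrow> ip s (x v) (x v') = 0)"
    using U by blast
qed

lemma subspace_choice_number_eq_Suc:
  assumes "subspace_choosable ip (k + 1) G" "\<not> subspace_choosable ip k G"
  shows "subspace_choice_number ip G = enat (k + 1)"
  unfolding subspace_choice_number_def
proof (rule antisym)
  show "Inf {enat j |j. 0 < j \<and> subspace_choosable ip j G} \<le> enat (k + 1)"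
    using assms(1) by (intro Inf_lower) auto
  have "k + 1 \<le> j" if "subspace_choosable ip j G" for j
    using subspace_choosable_mono[OF that] assms(2) by (metis Suc_eq_plus1 not_less_eq_eq)
  then show "enat (k + 1) \<le> Inf {enat j |j. 0 < j \<and> subspace_choosable ip j G}"
    by (intro Inf_greatest) auto
qed

lemma (in field_involution) bipartite_threshold_le:
  fixes u :: "nat \<Rightarrow> nat \<Rightarrow> 'a"
  assumes "m = k * (t - 1) + 1" "spanning_family k t m u"
  shows "bipartite_threshold pairing k \<le> enat m"
  unfolding bipartite_threshold_def
  using subspace_choice_number_eq_Suc[OF choosable_Suc not_choosable_of_spanning_family[OF assms]]
  by (intro Inf_lower) auto

theorem theorem1p5:
  fixes k t m :: nat
  assumes "k \<ge> 1" and "t \<ge> 1" and "m = k * (t - 1) + 1"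
  shows "((\<exists>u :: nat \<Rightarrow> nat \<Rightarrow> 'a::field. spanning_family k t m u) \<longrightarrow>
           bipartite_threshold (bilinear_ip :: 'a ip) k \<le> enat m) \<and>
         ((\<exists>u :: nat \<Rightarrow> nat \<Rightarrow> complex. spanning_family k t m u) \<longrightarrow>
           bipartite_threshold hermitian_ip k \<le> enat m)"
proof -
  interpret bil: field_involution "\<lambda>a :: 'a. a" by unfold_locales auto
  interpret herm: field_involution cnj by unfold_locales auto
  have "bil.pairing = bilinear_ip" "herm.pairing = hermitian_ip"
    by (simp_all add: fun_eq_iff bil.pairing_def herm.pairing_def bilinear_ip_def hermitian_ip_def)
  then show ?thesis
    using bil.bipartite_threshold_le herm.bipartite_threshold_le assms by metis
qed

end
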